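(* Let $(\Omega,\mathcal F,\mathsf P)$ be a probability space and let $(X_n)_{n\in\mathbb N}$ be a sequence of i.i.d. integrable random variables on it with $\mathsf E_{\mathsf P}[X_1]=0$. Let $S_n:=\sum_{i=1}^nX_i$ and $q\in[1,2)$. For any $m\in\mathbb N$ and $\varepsilon>0$, define $P_m^{(\varepsilon)}:=\mathsf P\big[\sup_{k\ge m}|k^{-1/q}S_k|\ge\varepsilon\big]$. Then, for any $\varepsilon>0$, $$\sum_{m=1}^\infty\frac{P_m^{(\varepsilon)}}{m}\le1+\frac{c_q}{e\log(2^{1/q-1/2})}+\frac{2603\,q\,\mathsf E_{\mathsf P}\big[|X_1|^q\log(38|X_1|^q/\varepsilon^q+1)\big]}{(2-q)^2(\varepsilon^2\wedge1)},$$ where $c_q:=4/(2-q)$.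
   Context: $\mathbb N=\{1,2,\dots\}$; $a\wedge b=\min(a,b)$; $\log$ is the natural logarithm and $e$ its base. The expectation on the right-hand side takes values in $[0,\infty]$ (the bound is trivial when it is infinite). *)

theory Defs
  imports "HOL-Probability.Probability"
begin

text \<open>The random variables are indexed by the positive naturals; the value at index 0 of a
  sequence is never used.\<close>

definition iid_seq :: "'a measure \<Rightarrow> (nat \<Rightarrow> 'a \<Rightarrow> real) \<Rightarrow> bool" where
  "iid_seq M X \<longleftrightarrow>
     prob_space.indep_vars M (\<lambda>_. borel) X {1..} \<and>
     (\<forall>n\<ge>1. distr M borel (X n) = distr M borel (X 1))"

definition partial_sum :: "(nat \<Rightarrow> 'a \<Rightarrow> real) \<Rightarrow> nat \<Rightarrow> 'a \<Rightarrow> real" where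
  "partial_sum X n \<omega> = (\<Sum>i=1..n. X i \<omega>)"

text \<open>The supremum is taken in the extended reals, as it may be infinite at some sample points.\<close>

definition tail_sup_prob ::
    "'a measure \<Rightarrow> (nat \<Rightarrow> 'a \<Rightarrow> real) \<Rightarrow> real \<Rightarrow> real \<Rightarrow> nat \<Rightarrow> real" where
  "tail_sup_prob M X q \<epsilon> m =
     measure M {\<omega> \<in> space M.
       (SUP k\<in>{m..}. ereal \<bar>real k powr (- 1 / q) * partial_sum X k \<omega>\<bar>) \<ge> ereal \<epsilon>}"

end

theory Submission
  imports Defs
begin

text \<open>Replacing \<open>X\<close> by \<open>X / \<epsilon>\<close> reduces the claim to \<open>\<epsilon> = 1\<close>, because
  \<open>\<epsilon> powr q \<ge> min (\<epsilon>\<^sup>2) 1\<close>. Write \<open>Z = \<bar>X 1\<bar> powr q\<close> and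
  \<open>L = E (Z ln (38 Z + 1))\<close>.

  A supremum that is at least \<open>1\<close> exceeds \<open>1/2\<close> at some index, so it is enough to control the
  events that \<open>\<bar>S\<^sub>k\<bar> > k powr (1/q) / 2\<close> for some \<open>k \<ge> m\<close>. Their probabilities decrease in
  \<open>m\<close>, hence by condensation (\<open>dyadic_condensation\<close>) the weights \<open>1/m\<close> turn the series into the
  sum over the dyadic values \<open>m = 2^j\<close>; the term \<open>j = 0\<close> is responsible for the
  summand \<open>1\<close> of the bound.

  Split the indices \<open>k\<close> into blocks \<open>2^i \<le> k < 2^(i+1)\<close>. On block \<open>i\<close> truncate the variables at
  \<open>\<bar>X\<bar> powr q \<le> 2^i\<close>. Either a variable is truncated, which has probability at most
  \<open>2^(i+1) P(Z > 2^i)\<close>, or the excess comes from the truncated variables. If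
  \<open>E (Z; Z > 2^i) \<le> 1/8\<close>, their means use up at most half of the threshold
  (\<open>truncated_mean_bound\<close>), and Kolmogorov's maximal inequality bounds the rest by a multiple of the
  truncated second moment (\<open>partial_sum_tail\<close>).

  For small \<open>i\<close> the drift condition can fail, and adding up these blocks with their multiplicity
  would cost the square of \<open>L\<close>. However, a failure at level \<open>i\<close> forces \<open>i \<le> 16 L\<close>
  (\<open>drift_level_bound\<close>). So the dyadic probabilities with \<open>j \<le> 16 L\<close> are bounded by \<open>1\<close>, which
  costs \<open>16 L\<close> altogether, and a union bound over blocks is used only for \<open>j > 16 L\<close>
  (\<open>sum_dyadic_tail_excess\<close>). There block \<open>i\<close> is counted at most \<open>i\<close> times, and since \<open>i\<close> is
  logarithmic in \<open>Z\<close> at the first relevant level, the weighted costs add up to a multiple of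
  \<open>Z ln (38 Z + 1)\<close>, up to an additive constant that takes care of small \<open>Z\<close>
  (\<open>weighted_cost_bound\<close>). The geometric ratio \<open>2 powr (1 - 2/q)\<close> of the variance terms produces
  the factor \<open>q / (2 - q)\<^sup>2\<close>.\<close>

section \<open>Kolmogorov's maximal inequality\<close>

text \<open>The partial sums of \<open>w\<close> stopped at their first crossing of level \<open>b\<close>: the final value alone
  records whether there was a crossing.\<close>

primrec stopped_sum :: "real \<Rightarrow> (nat \<Rightarrow> real) \<Rightarrow> nat \<Rightarrow> real" where
  "stopped_sum b w 0 = 0"
| "stopped_sum b w (Suc k) =
     stopped_sum b w k + (if \<bar>stopped_sum b w k\<bar> < b then w (Suc k) else 0)"

lemma stopped_sum_cong:
  "(\<And>i. 1 \<le> i \<Longrightarrow> i \<le> k \<Longrightarrow> v i = w i) \<Longrightarrow> stopped_sum b v k = stopped_sum b w k"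
  by (induction k) auto

lemma stopped_sum_before_crossing:
  assumes "\<And>j. j < k \<Longrightarrow> \<bar>\<Sum>i=1..j. w i\<bar> < b"
  shows "stopped_sum b w k = (\<Sum>i=1..k. w i)"
  using assms by (induction k) auto

lemma stopped_sum_after_crossing:
  assumes "b > 0" "k \<le> n" "b \<le> \<bar>\<Sum>i=1..k. w i\<bar>"
  shows "b \<le> \<bar>stopped_sum b w n\<bar>"
proof -
  define m where "m = (LEAST j. b \<le> \<bar>\<Sum>i=1..j. w i\<bar>)"
  have m: "b \<le> \<bar>\<Sum>i=1..m. w i\<bar>" and mk: "m \<le> k"
    unfolding m_def by (rule LeastI[of _ k], fact, rule Least_le, fact)
  have "\<bar>\<Sum>i=1..j. w i\<bar> < b" if "j < m" for j
    using not_less_Least[OF that[unfolded m_def]] by simp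
  then have "b \<le> \<bar>stopped_sum b w m\<bar>"
    using m stopped_sum_before_crossing[of m w b] by simp
  moreover have "b \<le> \<bar>stopped_sum b w n\<bar>" if "b \<le> \<bar>stopped_sum b w m\<bar>" "m \<le> n" for n
    using that(2,1) by (induction rule: dec_induct) auto
  ultimately show ?thesis using mk assms by simp
qed

lemma measurable_stopped_sum [measurable (raw)]:
  assumes "\<And>i. 1 \<le> i \<Longrightarrow> i \<le> k \<Longrightarrow> (\<lambda>x. w x i) \<in> borel_measurable M"
  shows "(\<lambda>x. stopped_sum b (w x) k) \<in> borel_measurable M"
  using assms
proof (induction k)
  case (Suc k)
  then have [measurable]: "(\<lambda>x. stopped_sum b (w x) k) \<in> borel_measurable M"
    "(\<lambda>x. w x (Suc k)) \<in> borel_measurable M" by auto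
  show ?case by simp
qed simp

context prob_space begin

text \<open>The stopped sum at time \<open>k\<close> depends only on the first \<open>k\<close> variables.\<close>

lemma indep_var_stopped_sum:
  assumes "indep_vars (\<lambda>_. borel) W {1..Suc k}"
  shows "indep_var borel (\<lambda>\<omega>. stopped_sum b (\<lambda>i. W i \<omega>) k) borel (W (Suc k))"
proof -
  have "indep_var
    borel ((\<lambda>f. stopped_sum b f k) \<circ> (\<lambda>\<omega>. restrict (\<lambda>i. W i \<omega>) {1..k}))
    borel ((\<lambda>f. f (Suc k)) \<circ> (\<lambda>\<omega>. restrict (\<lambda>i. W i \<omega>) {Suc k}))"
    by (intro indep_var_compose[OF indep_var_restrict[OF assms]] measurable_stopped_sum
        measurable_component_singleton) auto
  also have "(\<lambda>f. stopped_sum b f k) \<circ> (\<lambda>\<omega>. restrict (\<lambda>i. W i \<omega>) {1..k})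
      = (\<lambda>\<omega>. stopped_sum b (\<lambda>i. W i \<omega>) k)"
    by (auto simp: fun_eq_iff intro!: stopped_sum_cong)
  also have "(\<lambda>f. f (Suc k)) \<circ> (\<lambda>\<omega>. restrict (\<lambda>i. W i \<omega>) {Suc k}) = W (Suc k)"
    by auto
  finally show ?thesis .
qed

text \<open>Whether an increment is still added is decided by the past, which is independent of the
  increment. Thus the mixed term vanishes in each step, and dropping increments only makes the
  second moment smaller. Integrability of the square is part of the claim because the induction
  needs it.\<close>

lemma stopped_sum_second_moment:
  fixes W :: "nat \<Rightarrow> 'a \<Rightarrow> real"
  assumes "indep_vars (\<lambda>_. borel) W {1..n}"
    and "\<And>i. i \<in> {1..n} \<Longrightarrow> integrable M (W i)"
    and "\<And>i. i \<in> {1..n} \<Longrightarrow> integrable M (\<lambda>\<omega>. (W i \<omega>)\<^sup>2)"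
    and "\<And>i. i \<in> {1..n} \<Longrightarrow> expectation (W i) = 0"
  shows "integrable M (\<lambda>\<omega>. (stopped_sum b (\<lambda>i. W i \<omega>) n)\<^sup>2) \<and>
    expectation (\<lambda>\<omega>. (stopped_sum b (\<lambda>i. W i \<omega>) n)\<^sup>2)
      \<le> (\<Sum>i=1..n. expectation (\<lambda>\<omega>. (W i \<omega>)\<^sup>2))"
  using assms
proof (induction n)
  case (Suc k)
  let ?V = "\<lambda>\<omega>. stopped_sum b (\<lambda>i. W i \<omega>) k" and ?W = "W (Suc k)"
  define h where "h v = (if \<bar>v\<bar> < b then v else 0)" for v :: real
  define D where "D \<omega> = (if \<bar>?V \<omega>\<bar> < b then (?W \<omega>)\<^sup>2 else 0)" for \<omega>
  have [measurable]: "random_variable borel (W i)" if "i \<in> {1..Suc k}" for i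
    using Suc.prems(2)[OF that] by auto
  have [measurable]: "?W \<in> borel_measurable M" by simp
  have [measurable]: "?V \<in> borel_measurable M"
    by (intro measurable_stopped_sum) auto
  have [measurable]: "h \<in> borel_measurable borel"
    unfolding h_def by measurable
  have "indep_vars (\<lambda>_. borel) W {1..k}"
    using Suc.prems(1) by (rule indep_vars_subset) auto
  with Suc have IH: "integrable M (\<lambda>\<omega>. (?V \<omega>)\<^sup>2)"
    "expectation (\<lambda>\<omega>. (?V \<omega>)\<^sup>2) \<le> (\<Sum>i=1..k. expectation (\<lambda>\<omega>. (W i \<omega>)\<^sup>2))"
    by auto
  have ind: "indep_var borel (\<lambda>\<omega>. h (?V \<omega>)) borel ?W"
    using indep_var_compose[OF indep_var_stopped_sum[OF Suc.prems(1)], of h borel id borel b]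
    by (simp add: comp_def)
  have inth: "integrable M (\<lambda>\<omega>. h (?V \<omega>))"
    by (rule integrable_const_bound[where B="\<bar>b\<bar>"]) (auto simp: h_def)
  have intW: "integrable M ?W" and intW2: "integrable M (\<lambda>\<omega>. (?W \<omega>)\<^sup>2)"
    and W0: "expectation ?W = 0" using Suc.prems by auto
  \<comment> \<open>the factor \<open>h\<close> of the past is bounded, so the products below are integrable\<close>
  have int_cross: "integrable M (\<lambda>\<omega>. h (?V \<omega>) * ?W \<omega>)"
    by (rule indep_var_integrable[OF ind inth intW])
  have cross: "expectation (\<lambda>\<omega>. h (?V \<omega>) * ?W \<omega>) = 0"
    using indep_var_lebesgue_integral[OF ind inth intW] W0 by simp
  have intD: "integrable M D"
    unfolding D_def by (rule Bochner_Integration.integrable_bound[OF intW2]) auto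
  have D: "expectation D \<le> expectation (\<lambda>\<omega>. (?W \<omega>)\<^sup>2)"
    by (rule integral_mono[OF intD intW2]) (auto simp: D_def)
  have eq: "(\<lambda>\<omega>. (stopped_sum b (\<lambda>i. W i \<omega>) (Suc k))\<^sup>2)
      = (\<lambda>\<omega>. (?V \<omega>)\<^sup>2 + 2 * (h (?V \<omega>) * ?W \<omega>) + D \<omega>)"
    by (auto simp: fun_eq_iff h_def D_def power2_eq_square algebra_simps)
  show ?case
    unfolding eq using IH int_cross intD D cross by simp
qed simp

text \<open>A crossing of \<open>b\<close> by the partial sums is remembered by the stopped sum, so Markov's inequality
  for the square of the latter suffices.\<close>

lemma kolmogorov_maximal_inequality:
  fixes W :: "nat \<Rightarrow> 'a \<Rightarrow> real"
  assumes "indep_vars (\<lambda>_. borel) W {1..n}"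
    and int: "\<And>i. i \<in> {1..n} \<Longrightarrow> integrable M (W i)"
    and "\<And>i. i \<in> {1..n} \<Longrightarrow> integrable M (\<lambda>\<omega>. (W i \<omega>)\<^sup>2)"
    and "\<And>i. i \<in> {1..n} \<Longrightarrow> expectation (W i) = 0"
    and "b > 0"
  shows "prob {\<omega>\<in>space M. \<exists>k\<le>n. b \<le> \<bar>\<Sum>i=1..k. W i \<omega>\<bar>}
    \<le> (\<Sum>i=1..n. expectation (\<lambda>\<omega>. (W i \<omega>)\<^sup>2)) / b\<^sup>2"
proof -
  let ?V = "\<lambda>\<omega>. stopped_sum b (\<lambda>i. W i \<omega>) n"
  have V: "integrable M (\<lambda>\<omega>. (?V \<omega>)\<^sup>2)"
    "expectation (\<lambda>\<omega>. (?V \<omega>)\<^sup>2) \<le> (\<Sum>i=1..n. expectation (\<lambda>\<omega>. (W i \<omega>)\<^sup>2))"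
    using stopped_sum_second_moment[OF assms(1-4)] by auto
  have [measurable]: "?V \<in> borel_measurable M"
    using int by (intro measurable_stopped_sum) auto
  have "prob {\<omega>\<in>space M. \<exists>k\<le>n. b \<le> \<bar>\<Sum>i=1..k. W i \<omega>\<bar>}
      \<le> prob {\<omega>\<in>space M. b\<^sup>2 \<le> (?V \<omega>)\<^sup>2}"
  proof (rule finite_measure_mono)
    show "{\<omega>\<in>space M. \<exists>k\<le>n. b \<le> \<bar>\<Sum>i=1..k. W i \<omega>\<bar>} \<subseteq> {\<omega>\<in>space M. b\<^sup>2 \<le> (?V \<omega>)\<^sup>2}"
    proof safe
      fix \<omega> k assume "k \<le> n" "b \<le> \<bar>\<Sum>i=1..k. W i \<omega>\<bar>"
      then have "b \<le> \<bar>?V \<omega>\<bar>" by (rule stopped_sum_after_crossing[OF \<open>b > 0\<close>])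
      then show "b\<^sup>2 \<le> (?V \<omega>)\<^sup>2" using \<open>b > 0\<close> power_mono[of b "\<bar>?V \<omega>\<bar>" 2] by simp
    qed
  qed measurable
  also have "\<dots> \<le> expectation (\<lambda>\<omega>. (?V \<omega>)\<^sup>2) / b\<^sup>2"
    using \<open>b > 0\<close> by (intro integral_Markov_inequality_measure[where A="{}"] V) auto
  also have "\<dots> \<le> (\<Sum>i=1..n. expectation (\<lambda>\<omega>. (W i \<omega>)\<^sup>2)) / b\<^sup>2"
    using V by (intro divide_right_mono) auto
  finally show ?thesis .
qed

end

section \<open>Sums over dyadic levels\<close>

lemma one_le_ratio:
  fixes q :: real
  assumes "1 \<le> q" "q < 2"
  shows "1 \<le> q / (2 - q)\<^sup>2"
proof -
  have "(2 - q)\<^sup>2 \<le> q"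
    using assms mult_nonneg_nonneg[of "q - 1" "4 - q"]
    by (simp add: power2_eq_square algebra_simps)
  then show ?thesis using assms by simp
qed

text \<open>On \<open>[0, 1]\<close> the convex function \<open>s \<mapsto> 2 powr (- s)\<close> lies below its chord.\<close>

lemma geometric_ratio_bound:
  fixes s :: real
  assumes "0 < s" "s \<le> 1"
  shows "s / 2 \<le> 1 - 2 powr (- s)"
proof -
  have "1 powr (1 - s) * (1/2) powr s \<le> (1 - s) * 1 + s * (1/2 :: real)"
    using assms by (intro Youngs_inequality_0) auto
  then show ?thesis by (simp add: powr_minus powr_divide field_simps)
qed

lemma index_le_log_weight:
  assumes "2 ^ i < z"
  shows "real i \<le> 2 * ln (38 * z + 1)"
proof -
  have z: "1 \<le> z" using assms one_le_power[of "2::real" i] by linarith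
  have "real i * (1/2) \<le> real i * ln 2"
    using ln2_ge_two_thirds by (intro mult_left_mono) auto
  also have "\<dots> = ln (2 ^ i)" by (simp add: ln_realpow)
  also have "\<dots> \<le> ln (38 * z + 1)" using assms z by (subst ln_le_cancel_iff) auto
  finally show ?thesis by simp
qed

lemma sum_powers_below:
  assumes "0 \<le> (z::real)"
  shows "(\<Sum>i<N. if 2 ^ i < z then 2 ^ Suc i else 0) \<le> 4 * z"
proof (induction N)
  case (Suc N)
  show ?case
  proof (cases "2 ^ N < z")
    case True
    have "(\<Sum>i<Suc N. if 2 ^ i < z then 2 ^ Suc i else 0) \<le> (\<Sum>i<Suc N. 2 * 2 ^ i :: real)"
      by (intro sum_mono) auto
    also have "\<dots> = 2 * (2 ^ Suc N - 1)"
      by (simp add: sum_distrib_left[symmetric] sum_gp_strict del: sum.lessThan_Suc)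
    also have "\<dots> \<le> 4 * z" using True by simp
    finally show ?thesis .
  qed (use Suc in simp)
qed (use assms in simp)

text \<open>The levels below \<open>z\<close> have logarithmic index, and their powers of two form a geometric sum
  dominated by the largest one.\<close>

lemma weighted_tail_levels:
  assumes z: "0 \<le> (z::real)"
  shows "(\<Sum>i. ennreal (if 2 ^ i < z then real i * 2 ^ Suc i else 0))
    \<le> ennreal (8 * (z * ln (38 * z + 1)))"
proof (rule suminf_le_const[OF summableI])
  fix N
  let ?l = "ln (38 * z + 1)"
  have l: "0 \<le> ?l" using z by simp
  have "(\<Sum>i<N. if 2 ^ i < z then real i * 2 ^ Suc i else 0)
      \<le> (\<Sum>i<N. 2 * ?l * (if 2 ^ i < z then 2 ^ Suc i else 0))"
    using index_le_log_weight[of _ z] by (intro sum_mono) (auto intro!: mult_right_mono)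
  also have "\<dots> \<le> 2 * ?l * (4 * z)"
    unfolding sum_distrib_left[symmetric] using l sum_powers_below[OF z]
    by (intro mult_left_mono) auto
  finally show "(\<Sum>i<N. ennreal (if 2 ^ i < z then real i * 2 ^ Suc i else 0))
      \<le> ennreal (8 * (z * ?l))"
    by (subst sum_ennreal) (auto intro!: ennreal_leI simp: mult_ac)
qed

text \<open>This is applied to the least \<open>i\<close> with \<open>z \<le> 2^i\<close>. If \<open>z > 1\<close>, then \<open>i + 1\<close> is at most
  the binary logarithm of \<open>4 z\<close>. For \<open>z \<le> 1\<close> that index is \<open>0\<close>, while the logarithm degenerates as
  \<open>z\<close> tends to \<open>0\<close>; the additive \<open>1/64\<close> absorbs the values
  \<open>z \<le> 1/64\<close>, and for larger \<open>z\<close> the logarithm is at least \<open>1/3\<close>.\<close>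

lemma first_level_le_log_weight:
  assumes z: "0 \<le> (z::real)" and first: "\<And>j. j < i \<Longrightarrow> 2 ^ j < z"
  shows "z * (real i + 1) \<le> 1 / 64 + 3 * (z * ln (38 * z + 1))"
proof (cases i)
  case 0
  have "z \<le> 1/64 \<or> 1 \<le> 3 * ln (38 * z + 1)"
  proof (rule disjCI)
    assume "\<not> 1 \<le> 3 * ln (38 * z + 1)"
    moreover have "1 - 1 / (38 * z + 1) \<le> ln (38 * z + 1)"
      using ln_le_minus_one[of "1 / (38 * z + 1)"] z by (simp add: ln_div)
    ultimately have "1 - 1 / (38 * z + 1) < 1/3" by linarith
    then show "z \<le> 1/64" using z by (simp add: field_simps)
  qed
  then have "z \<le> 1 / 64 + 3 * (z * ln (38 * z + 1))"
  proof
    assume "z \<le> 1 / 64"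
    moreover have "0 \<le> z * ln (38 * z + 1)" using z by simp
    ultimately show ?thesis by linarith
  next
    assume "1 \<le> 3 * ln (38 * z + 1)"
    then show ?thesis using mult_left_mono[OF _ z] by fastforce
  qed
  then show ?thesis using 0 by simp
next
  case (Suc j)
  then have j: "2 ^ j < z" using first by simp
  then have "1 \<le> z" using one_le_power[of "2::real" j] by linarith
  have "(real i + 1) / 2 \<le> (real i + 1) * ln 2"
    using ln2_ge_two_thirds mult_left_mono[of "1 / 2" "ln 2" "real i + 1"] by linarith
  also have "(real i + 1) * ln 2 = ln (4 * 2 ^ j)"
    using Suc ln_realpow[of 2 "j + 2"] by (simp add: algebra_simps)
  also have "\<dots> \<le> ln (38 * z + 1)"
    using j \<open>1 \<le> z\<close> by (subst ln_le_cancel_iff) auto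
  finally have "(real i + 1) / 2 \<le> ln (38 * z + 1)" .
  moreover have "0 \<le> ln (38 * z + 1)" using z by simp
  moreover
  have "a \<le> 3 * l" if "a / 2 \<le> l" "0 \<le> l" for a l :: real using that by linarith
  ultimately have "real i + 1 \<le> 3 * ln (38 * z + 1)" by blast
  then show ?thesis using mult_left_mono[OF _ z] by fastforce
qed

text \<open>The series starts at the least \<open>m\<close> with \<open>z \<le> 2^m\<close>, where the geometric factor already
  compensates \<open>z powr s\<close>. From there on the terms are at most
  \<open>z (m + 1) (k + 1) r^k\<close> with \<open>k = i - m\<close>, and the sum of \<open>(k + 1) r^k\<close> is
  \<open>1 / (1 - r)\<^sup>2\<close>.\<close>

lemma weighted_truncated_levels:
  fixes z s :: real
  defines "r \<equiv> 2 powr (- s)"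
  assumes z: "0 \<le> z" and s: "0 < s"
  shows "(\<Sum>i. ennreal (if z \<le> 2 ^ i then real i * (r ^ i * z powr (1 + s)) else 0))
    \<le> ennreal ((1 / 64 + 3 * (z * ln (38 * z + 1))) / (1 - r)\<^sup>2)"
proof -
  define m where "m = (LEAST i. z \<le> 2 ^ i)"
  have "\<exists>i. z \<le> 2 ^ i"
    using real_arch_pow[of 2 z] by (auto intro: less_imp_le)
  then have m: "z \<le> 2 ^ m" unfolding m_def by (rule LeastI_ex)
  have m_le: "m \<le> i" if "z \<le> 2 ^ i" for i unfolding m_def by (rule Least_le) fact
  have before_m: "2 ^ j < z" if "j < m" for j using m_le[of j] that by force
  have r: "0 < r" "r < 1" using s by (auto simp: r_def powr_less_one)
  have rpow: "r ^ i = (2 ^ i) powr (- s)" for i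
    by (simp add: r_def powr_powr powr_realpow[symmetric] mult.commute)
  have top: "r ^ m * z powr (1 + s) \<le> z"
  proof (cases "z = 0")
    case False
    then have "z powr s \<le> (2 ^ m) powr s" using m z s by (intro powr_mono2) auto
    then have "(2 ^ m) powr (- s) * z powr s \<le> 1"
      by (simp add: powr_minus field_simps)
    then show ?thesis using False z mult_left_mono[of _ 1 z]
      by (simp add: rpow powr_add mult_ac)
  qed simp
  \<comment> \<open>a summable majorant, using \<open>m + k \<le> (m + 1) * (k + 1)\<close>\<close>
  define g where "g i = (if i < m then 0 else
      z * (real m + 1) * (real (Suc (i - m)) * r ^ (i - m)))" for i
  have "(\<lambda>k. g (k + m)) sums (z * (real m + 1) * (1 / (1 - r)\<^sup>2))"
    unfolding g_def using sums_mult[OF geometric_deriv_sums[of r]] r by simp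
  then have g: "g sums (z * (real m + 1) * (1 / (1 - r)\<^sup>2))"
    by (subst (asm) sums_iff_shift) (simp add: g_def)
  have "(if z \<le> 2 ^ i then real i * (r ^ i * z powr (1 + s)) else 0) \<le> g i" for i
  proof (cases "z \<le> 2 ^ i")
    case True
    then obtain k where i: "i = m + k" using m_le le_Suc_ex by blast
    have "real i * (r ^ i * z powr (1 + s)) = real i * (r ^ k * (r ^ m * z powr (1 + s)))"
      by (simp add: i power_add)
    also have "\<dots> \<le> ((real m + 1) * real (Suc k)) * (r ^ k * z)"
      using r z top by (intro mult_mono) (auto simp: i algebra_simps)
    finally show ?thesis using True by (simp add: g_def i mult_ac)
  qed (use z r in \<open>simp add: g_def\<close>)
  then have "(\<Sum>i. ennreal (if z \<le> 2 ^ i then real i * (r ^ i * z powr (1 + s)) else 0))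
      \<le> (\<Sum>i. ennreal (g i))"
    by (intro suminf_le ennreal_leI) auto
  also have "\<dots> = ennreal (z * (real m + 1) * (1 / (1 - r)\<^sup>2))"
    using z r by (intro suminf_ennreal_eq[OF _ g]) (auto simp: g_def)
  also have "\<dots> \<le> ennreal ((1 / 64 + 3 * (z * ln (38 * z + 1))) / (1 - r)\<^sup>2)"
    using first_level_le_log_weight[OF z, of m] before_m
    by (intro ennreal_leI) (auto intro!: divide_right_mono)
  finally show ?thesis .
qed

text \<open>The total weight \<open>1/m\<close> of the block \<open>2^j \<le> m < 2^(j+1)\<close> is at most \<open>1\<close>.\<close>

lemma dyadic_condensation:
  fixes R :: "nat \<Rightarrow> real"
  assumes dec: "\<And>m n. 1 \<le> m \<Longrightarrow> m \<le> n \<Longrightarrow> R n \<le> R m" and nonneg: "\<And>m. 0 \<le> R m"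
  shows "(\<Sum>m. ennreal (R (Suc m) / real (Suc m))) \<le> (\<Sum>j. ennreal (R (2 ^ j)))"
proof (rule suminf_le_const[OF summableI])
  fix N :: nat
  have blocks: "(\<Sum>m=1..<2 ^ J. R m / real m) \<le> (\<Sum>j<J. R (2 ^ j))" for J
  proof (induction J)
    case (Suc J)
    have "(\<Sum>m=1..<2 ^ Suc J. R m / real m)
        = (\<Sum>m=1..<2 ^ J. R m / real m) + (\<Sum>m=2 ^ J..<2 ^ Suc J. R m / real m)"
      by (rule sum.atLeastLessThan_concat[symmetric]) auto
    also have "(\<Sum>m=2 ^ J..<2 ^ Suc J. R m / real m)
        \<le> (\<Sum>m\<in>{2 ^ J..<2 ^ Suc J :: nat}. R (2 ^ J) / 2 ^ J)"
    proof (intro sum_mono frac_le dec)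
      fix m :: nat assume "m \<in> {2 ^ J..<2 ^ Suc J}"
      then show "2 ^ J \<le> real m" by (metis atLeastLessThan_iff of_nat_le_iff of_nat_numeral of_nat_power)
    qed (auto simp: nonneg)
    also have "\<dots> = R (2 ^ J)" by simp
    finally show ?case using Suc by simp
  qed simp
  have "(\<Sum>m<N. R (Suc m) / real (Suc m)) = (\<Sum>m=1..<Suc N. R m / real m)"
    by (simp add: sum.shift_bounds_Suc_ivl lessThan_atLeast0 del: sum.op_ivl_Suc of_nat_Suc)
  also have "\<dots> \<le> (\<Sum>m=1..<2 ^ N. R m / real m)"
    by (intro sum_mono2) (auto simp: nonneg Suc_le_eq less_exp intro: less_le_trans)
  also have "\<dots> \<le> (\<Sum>j<N. R (2 ^ j))" by (rule blocks)
  finally have "(\<Sum>m<N. ennreal (R (Suc m) / real (Suc m))) \<le> (\<Sum>j<N. ennreal (R (2 ^ j)))"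
    by (simp add: sum_ennreal nonneg ennreal_leI)
  also have "\<dots> \<le> (\<Sum>j. ennreal (R (2 ^ j)))" by (rule sum_le_suminf) auto
  finally show "(\<Sum>m<N. ennreal (R (Suc m) / real (Suc m))) \<le> (\<Sum>j. ennreal (R (2 ^ j)))" .
qed

lemma suminf_tails_swap:
  fixes p :: "nat \<Rightarrow> ennreal"
  shows "(\<Sum>j. \<Sum>i. if Suc j \<le> i then p i else 0) = (\<Sum>i. of_nat i * p i)"
proof -
  have "(\<Sum>j. \<Sum>i. if Suc j \<le> i then p i else 0)
      = (\<Sum>j. \<integral>\<^sup>+i. (if Suc j \<le> i then p i else 0) \<partial>count_space UNIV)"
    by (simp add: nn_integral_count_space_nat)
  also have "\<dots> = (\<integral>\<^sup>+i. (\<Sum>j. if Suc j \<le> i then p i else 0) \<partial>count_space UNIV)"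
    by (rule nn_integral_suminf[symmetric]) simp
  also have "\<dots> = (\<Sum>i. \<Sum>j. if Suc j \<le> i then p i else 0)"
    by (rule nn_integral_count_space_nat)
  also have "(\<lambda>i. \<Sum>j. if Suc j \<le> i then p i else 0) = (\<lambda>i. of_nat i * p i)"
  proof
    fix i
    show "(\<Sum>j. if Suc j \<le> i then p i else 0) = of_nat i * p i"
      by (subst suminf_finite[of "{..<i}"]) auto
  qed
  finally show ?thesis .
qed

lemma suminf_indicator_levels:
  fixes K :: ennreal
  shows "(\<Sum>j. if of_nat (Suc j) \<le> K then 1 else 0) \<le> K"
proof (rule suminf_le_const[OF summableI])
  fix N
  show "(\<Sum>j<N. if of_nat (Suc j) \<le> K then 1 else 0) \<le> K"
  proof (induction N)
    case (Suc N)
    show ?case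
    proof (cases "of_nat (Suc N) \<le> K")
      case True
      have "(\<Sum>j<Suc N. if of_nat (Suc j) \<le> K then 1 else 0) \<le> (\<Sum>j<Suc N. 1 :: ennreal)"
        by (intro sum_mono) auto
      then show ?thesis using True by (simp del: sum.lessThan_Suc)
    qed (use Suc in simp)
  qed simp
qed

section \<open>The cost of a block\<close>

text \<open>Half of the threshold in the theorem (for \<open>\<epsilon> = 1\<close>): a supremum may fail to be attained, but half
  of it is exceeded at some index.\<close>

definition threshold :: "real \<Rightarrow> nat \<Rightarrow> real" where
  "threshold q k = real k powr (1 / q) / 2"

text \<open>The expectation of \<open>block_cost q i (X 1)\<close> bounds the probability of an excess in block \<open>i\<close> if
  the drift of the truncated variables is small. The first summand pays for a variable above the truncation level, the second one is the Kolmogorov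
  bound. The double power in it is just \<open>x\<^sup>2\<close>, expressed by \<open>\<bar>x\<bar> powr q\<close>.\<close>

definition block_cost :: "real \<Rightarrow> nat \<Rightarrow> real \<Rightarrow> real" where
  "block_cost q i x = (if 2 ^ i < \<bar>x\<bar> powr q then 2 ^ Suc i else 0)
    + 32 * (if \<bar>x\<bar> powr q \<le> 2 ^ i
        then (2 powr (- (2 / q - 1))) ^ i * (\<bar>x\<bar> powr q) powr (1 + (2 / q - 1)) else 0)"

lemma measurable_block_cost [measurable]: "block_cost q i \<in> borel_measurable borel"
  unfolding block_cost_def by measurable

text \<open>The coefficient \<open>776 = 8 + 3 \<cdot> 256\<close> is the one of \<open>weighted_tail_levels\<close> plus \<open>3\<close> times
  \<open>32 \<cdot> 8\<close>, the factor of the second summand of the cost times the bound \<open>8 q / (2 - q)\<^sup>2\<close> for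
  \<open>1 / (1 - r)\<^sup>2\<close>. The latter follows from \<open>1 - r \<ge> s / 2\<close> with \<open>s = (2 - q) / q\<close>.\<close>

lemma weighted_cost_bound:
  fixes q x :: real
  assumes q: "1 \<le> q" "q < 2"
  shows "(\<Sum>i. of_nat i * ennreal (block_cost q i x))
    \<le> ennreal (4 * q / (2 - q)\<^sup>2)
      + ennreal (776 * q / (2 - q)\<^sup>2) * ennreal (\<bar>x\<bar> powr q * ln (38 * \<bar>x\<bar> powr q + 1))"
proof -
  define z where "z = \<bar>x\<bar> powr q"
  define s where "s = 2 / q - 1"
  define r where "r = 2 powr (- s)"
  define L where "L = z * ln (38 * z + 1)"
  have z: "0 \<le> z" and L: "0 \<le> L" by (auto simp: z_def L_def)
  have s: "0 < s" "s \<le> 1" using q by (auto simp: s_def field_simps)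
  have "(s / 2)\<^sup>2 \<le> (1 - r)\<^sup>2"
    using geometric_ratio_bound[OF s] s by (intro power_mono) (auto simp: r_def)
  moreover have "0 < (s / 2)\<^sup>2" using s by simp
  ultimately have "1 / (1 - r)\<^sup>2 \<le> 1 / (s / 2)\<^sup>2"
    by (intro divide_left_mono mult_pos_pos) auto
  also have "1 / (s / 2)\<^sup>2 = q * (4 * q / (2 - q)\<^sup>2)"
    using q by (simp add: s_def power2_eq_square field_simps)
  also have "\<dots> \<le> 2 * (4 * q / (2 - q)\<^sup>2)"
    using q by (intro mult_right_mono) auto
  finally have ratio: "1 / (1 - r)\<^sup>2 \<le> 8 * q / (2 - q)\<^sup>2" by simp
  have one: "1 \<le> q / (2 - q)\<^sup>2" using q by (rule one_le_ratio)
  have "(\<Sum>i. of_nat i * ennreal (block_cost q i x))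
      = (\<Sum>i. ennreal (if 2 ^ i < z then real i * 2 ^ Suc i else 0)
        + 32 * ennreal (if z \<le> 2 ^ i then real i * (r ^ i * z powr (1 + s)) else 0))"
    unfolding z_def[symmetric] block_cost_def s_def[symmetric] r_def[symmetric]
  proof (rule suminf_cong)
    fix i
    have split: "of_nat i * ennreal (a + 32 * b) = ennreal (real i * a) + 32 * ennreal (real i * b)"
      if "0 \<le> a" "0 \<le> b" for a b
      using that by (simp add: ennreal_of_nat_eq_real_of_nat ennreal_mult distrib_left mult_ac)
    show "of_nat i * ennreal ((if 2 ^ i < z then 2 ^ Suc i else 0)
        + 32 * (if z \<le> 2 ^ i then r ^ i * z powr (1 + s) else 0))
      = ennreal (if 2 ^ i < z then real i * 2 ^ Suc i else 0)
        + 32 * ennreal (if z \<le> 2 ^ i then real i * (r ^ i * z powr (1 + s)) else 0)"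
      by (subst split) (auto simp: r_def)
  qed
  also have "\<dots> = (\<Sum>i. ennreal (if 2 ^ i < z then real i * 2 ^ Suc i else 0))
        + 32 * (\<Sum>i. ennreal (if z \<le> 2 ^ i then real i * (r ^ i * z powr (1 + s)) else 0))"
    by (simp add: suminf_add[symmetric] summableI)
  also have "\<dots> \<le> ennreal (8 * L) + 32 * ennreal ((1 / 64 + 3 * L) / (1 - r)\<^sup>2)"
    unfolding L_def r_def using z s
    by (intro add_mono mult_left_mono weighted_tail_levels weighted_truncated_levels) auto
  also have "\<dots> = ennreal (8 * L + 32 * ((1 / 64 + 3 * L) * (1 / (1 - r)\<^sup>2)))"
  proof -
    have "32 * ennreal a = ennreal (32 * a)" if "0 \<le> a" for a
      using that by (simp add: ennreal_mult)
    then show ?thesis using L by (simp add: ennreal_plus[symmetric] del: ennreal_plus)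
  qed
  also have "\<dots> \<le> ennreal (8 * L * (q / (2 - q)\<^sup>2) + 32 * ((1 / 64 + 3 * L) * (8 * q / (2 - q)\<^sup>2)))"
    using L ratio one mult_left_mono[OF one, of "8 * L"]
    by (intro ennreal_leI add_mono mult_left_mono) auto
  also have "\<dots> = ennreal (4 * q / (2 - q)\<^sup>2 + 776 * q / (2 - q)\<^sup>2 * L)"
    by (intro arg_cong[of _ _ ennreal]) (simp add: algebra_simps add_divide_distrib[symmetric])
  also have "\<dots> = ennreal (4 * q / (2 - q)\<^sup>2) + ennreal (776 * q / (2 - q)\<^sup>2) * ennreal L"
    using L q by (simp add: ennreal_mult[symmetric] ennreal_plus[symmetric] del: ennreal_plus)
  finally show ?thesis by (simp add: L_def z_def)
qed

section \<open>Excess of partial sums in a block\<close>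

locale centred_iid = prob_space +
  fixes X :: "nat \<Rightarrow> 'a \<Rightarrow> real"
  assumes iid: "iid_seq M X"
    and integrable_X: "\<And>n. 1 \<le> n \<Longrightarrow> integrable M (X n)"
    and mean_zero: "expectation (X 1) = 0"
begin

lemma measurable_X [measurable]: "1 \<le> n \<Longrightarrow> X n \<in> borel_measurable M"
  using integrable_X by auto

text \<open>The simplifier writes the index \<open>1\<close> as \<open>Suc 0\<close>.\<close>

lemma measurable_X_Suc_0 [measurable]: "X (Suc 0) \<in> borel_measurable M"
  by simp

lemma integral_X:
  fixes g :: "real \<Rightarrow> real"
  assumes "1 \<le> n" and [measurable]: "g \<in> borel_measurable borel"
  shows "expectation (\<lambda>\<omega>. g (X n \<omega>)) = expectation (\<lambda>\<omega>. g (X 1 \<omega>))"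
proof -
  have [measurable]: "X n \<in> borel_measurable M" using assms by simp
  have "expectation (\<lambda>\<omega>. g (X n \<omega>)) = (\<integral>x. g x \<partial>distr M borel (X n))"
    by (simp add: integral_distr)
  also have "distr M borel (X n) = distr M borel (X 1)"
    using iid \<open>1 \<le> n\<close> unfolding iid_seq_def by blast
  also have "(\<integral>x. g x \<partial>distr M borel (X 1)) = expectation (\<lambda>\<omega>. g (X 1 \<omega>))"
    by (simp add: integral_distr)
  finally show ?thesis .
qed

lemma prob_X:
  assumes "1 \<le> n" and [measurable]: "A \<in> sets borel"
  shows "prob {\<omega>\<in>space M. X n \<omega> \<in> A} = prob {\<omega>\<in>space M. X 1 \<omega> \<in> A}"
proof -
  have [measurable]: "X n \<in> borel_measurable M" using assms by simp
  have "measure (distr M borel (X n)) A = measure (distr M borel (X 1)) A"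
    using iid \<open>1 \<le> n\<close> unfolding iid_seq_def by metis
  then show ?thesis by (simp add: measure_distr vimage_def Int_def conj_commute)
qed

text \<open>The untruncated mean is zero, so the mean of the truncated variable is minus that of the removed
  part. On the removed part \<open>\<bar>x\<bar> powr q > c\<close>, whence
  \<open>\<bar>x\<bar> = (\<bar>x\<bar> powr q) powr (1/q - 1) * \<bar>x\<bar> powr q \<le> c powr (1/q - 1) * \<bar>x\<bar> powr q\<close>. The factor
  \<open>2 * c\<close> stands for the length of the sums.\<close>

lemma truncated_mean_bound:
  fixes q c :: real
  defines "tr \<equiv> \<lambda>x::real. if \<bar>x\<bar> powr q \<le> c then x else 0"
  assumes q: "1 \<le> q" and c: "0 < c"
    and drift: "(\<integral>\<^sup>+\<omega>. ennreal (if c < \<bar>X 1 \<omega>\<bar> powr q then \<bar>X 1 \<omega>\<bar> powr q else 0) \<partial>M)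
      \<le> ennreal (1 / 8)"
  shows "2 * c * \<bar>expectation (\<lambda>\<omega>. tr (X 1 \<omega>))\<bar> \<le> c powr (1 / q) / 4"
proof -
  have [measurable]: "tr \<in> borel_measurable borel" unfolding tr_def by measurable
  have inttr: "integrable M (\<lambda>\<omega>. tr (X 1 \<omega>))"
    by (rule Bochner_Integration.integrable_bound[OF integrable_X[of 1]]) (auto simp: tr_def)
  have tail: "\<bar>x - tr x\<bar> \<le> c powr (1 / q - 1) * (if c < \<bar>x\<bar> powr q then \<bar>x\<bar> powr q else 0)" for x
  proof (cases "c < \<bar>x\<bar> powr q")
    case True
    then have x: "0 < \<bar>x\<bar>" using c by (cases "x = 0") auto
    have "\<bar>x\<bar> = (\<bar>x\<bar> powr q) powr (1 / q - 1) * \<bar>x\<bar> powr q"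
      using x q by (simp add: powr_powr powr_add[symmetric] algebra_simps)
    also have "\<dots> \<le> c powr (1 / q - 1) * \<bar>x\<bar> powr q"
      using True c q by (intro mult_right_mono powr_mono2') auto
    finally show ?thesis using True by (simp add: tr_def)
  qed (simp add: tr_def)
  have "expectation (\<lambda>\<omega>. tr (X 1 \<omega>)) = - expectation (\<lambda>\<omega>. X 1 \<omega> - tr (X 1 \<omega>))"
    using integrable_X[of 1] inttr mean_zero by (simp add: Bochner_Integration.integral_diff)
  then have "ennreal \<bar>expectation (\<lambda>\<omega>. tr (X 1 \<omega>))\<bar>
      = ennreal (norm (expectation (\<lambda>\<omega>. X 1 \<omega> - tr (X 1 \<omega>))))" by simp
  also have "\<dots> \<le> (\<integral>\<^sup>+\<omega>. ennreal (norm (X 1 \<omega> - tr (X 1 \<omega>))) \<partial>M)"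
    using integrable_X[of 1] inttr by (intro integral_norm_bound_ennreal) auto
  also have "\<dots> \<le> (\<integral>\<^sup>+\<omega>. ennreal (c powr (1 / q - 1))
      * ennreal (if c < \<bar>X 1 \<omega>\<bar> powr q then \<bar>X 1 \<omega>\<bar> powr q else 0) \<partial>M)"
  proof (rule nn_integral_mono)
    fix \<omega>
    let ?t = "if c < \<bar>X 1 \<omega>\<bar> powr q then \<bar>X 1 \<omega>\<bar> powr q else 0"
    have "ennreal (norm (X 1 \<omega> - tr (X 1 \<omega>))) \<le> ennreal (c powr (1 / q - 1) * ?t)"
      using tail unfolding real_norm_def by (rule ennreal_leI)
    also have "\<dots> = ennreal (c powr (1 / q - 1)) * ennreal ?t" by (rule ennreal_mult) auto
    finally show "ennreal (norm (X 1 \<omega> - tr (X 1 \<omega>))) \<le> ennreal (c powr (1 / q - 1)) * ennreal ?t" .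
  qed
  also have "\<dots> = ennreal (c powr (1 / q - 1))
      * (\<integral>\<^sup>+\<omega>. ennreal (if c < \<bar>X 1 \<omega>\<bar> powr q then \<bar>X 1 \<omega>\<bar> powr q else 0) \<partial>M)"
    by (intro nn_integral_cmult) measurable
  also have "\<dots> \<le> ennreal (c powr (1 / q - 1)) * ennreal (1 / 8)"
    using drift by (intro mult_left_mono) auto
  also have "\<dots> = ennreal (c powr (1 / q - 1) / 8)"
    by (simp add: ennreal_mult[symmetric])
  finally have "\<bar>expectation (\<lambda>\<omega>. tr (X 1 \<omega>))\<bar> \<le> c powr (1 / q - 1) / 8" by simp
  then have "2 * c * \<bar>expectation (\<lambda>\<omega>. tr (X 1 \<omega>))\<bar> \<le> 2 * c * (c powr (1 / q - 1) / 8)"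
    using c by (intro mult_left_mono) auto
  also have "\<dots> = c powr (1 / q) / 4"
    using c by (simp add: powr_diff)
  finally show ?thesis .
qed

text \<open>If no variable up to time \<open>n\<close> is truncated, the partial sum equals the centred truncated sum plus
  a drift of at most \<open>c powr (1/q) / 4\<close>. So the centred sum has to exceed the remaining
  \<open>c powr (1/q) / 4\<close>, and Kolmogorov's inequality applies.\<close>

lemma partial_sum_tail:
  fixes q c :: real
  assumes q: "1 \<le> q" and c: "0 < c" and n: "real n \<le> 2 * c"
    and drift: "(\<integral>\<^sup>+\<omega>. ennreal (if c < \<bar>X 1 \<omega>\<bar> powr q then \<bar>X 1 \<omega>\<bar> powr q else 0) \<partial>M)
      \<le> ennreal (1 / 8)"
  shows "emeasure M {\<omega>\<in>space M. \<exists>k\<le>n. c powr (1 / q) / 2 < \<bar>partial_sum X k \<omega>\<bar>}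
    \<le> (\<integral>\<^sup>+\<omega>. ennreal (real n * (if c < \<bar>X 1 \<omega>\<bar> powr q then 1 else 0)
      + 16 * real n * c powr (- 2 / q) * (if \<bar>X 1 \<omega>\<bar> powr q \<le> c then (X 1 \<omega>)\<^sup>2 else 0)) \<partial>M)"
proof -
  define tr where "tr x = (if \<bar>x\<bar> powr q \<le> c then x else 0)" for x :: real
  define \<mu> where "\<mu> = expectation (\<lambda>\<omega>. tr (X 1 \<omega>))"
  define W where "W i \<omega> = tr (X i \<omega>) - \<mu>" for i \<omega>
  \<comment> \<open>half of the level in the claim; the other half is left for the drift\<close>
  define b where "b = c powr (1 / q) / 4"
  have b: "0 < b" using c by (simp add: b_def)
  have [measurable]: "tr \<in> borel_measurable borel" unfolding tr_def by measurable
  have mX: "1 \<le> i \<Longrightarrow> X i \<in> borel_measurable M" for i by simp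
  have tr_bound: "\<bar>tr x\<bar> \<le> c powr (1 / q)" for x
  proof (cases "\<bar>x\<bar> powr q \<le> c")
    case True
    then have "(\<bar>x\<bar> powr q) powr (1 / q) \<le> c powr (1 / q)" using q by (intro powr_mono2) auto
    then show ?thesis using True q by (simp add: tr_def powr_powr)
  qed (simp add: tr_def)
  have int_tr: "integrable M (\<lambda>\<omega>. tr (X i \<omega>))" if "1 \<le> i" for i
    using mX[OF that] tr_bound
    by (intro integrable_const_bound[where B="c powr (1 / q)"]) auto
  have int_tr2: "integrable M (\<lambda>\<omega>. (tr (X i \<omega>))\<^sup>2)" if "1 \<le> i" for i
    using mX[OF that] power_mono[OF tr_bound, of _ 2]
    by (intro integrable_const_bound[where B="(c powr (1 / q))\<^sup>2"]) auto
  have mean_tr: "expectation (\<lambda>\<omega>. tr (X i \<omega>)) = \<mu>" if "1 \<le> i" for i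
    unfolding \<mu>_def using that by (rule integral_X) measurable
  have mean_tr2: "expectation (\<lambda>\<omega>. (tr (X i \<omega>))\<^sup>2) = expectation (\<lambda>\<omega>. (tr (X 1 \<omega>))\<^sup>2)"
    if "1 \<le> i" for i using integral_X[OF that, of "\<lambda>x. (tr x)\<^sup>2"] by simp
  have eqW2: "(\<lambda>\<omega>. (W i \<omega>)\<^sup>2) = (\<lambda>\<omega>. (tr (X i \<omega>))\<^sup>2 - 2 * \<mu> * tr (X i \<omega>) + \<mu>\<^sup>2)" for i
    by (auto simp: W_def power2_eq_square algebra_simps)
  have "2 * c * \<bar>\<mu>\<bar> \<le> b"
    unfolding \<mu>_def tr_def b_def by (rule truncated_mean_bound[OF q c drift])
  with mult_right_mono[OF n, of "\<bar>\<mu>\<bar>"] have drift': "real n * \<bar>\<mu>\<bar> \<le> b" by linarith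
  have indep: "indep_vars (\<lambda>_. borel) W {1..n}"
  proof -
    have "indep_vars (\<lambda>_. borel) X {1..n}"
      using iid unfolding iid_seq_def by (auto intro: indep_vars_subset)
    then have "indep_vars (\<lambda>_. borel) (\<lambda>i \<omega>. tr (X i \<omega>) - \<mu>) {1..n}"
      by (rule indep_vars_compose2) measurable
    then show ?thesis by (simp add: W_def[abs_def])
  qed
  have kol: "prob {\<omega>\<in>space M. \<exists>k\<le>n. b \<le> \<bar>\<Sum>i=1..k. W i \<omega>\<bar>}
      \<le> real n * expectation (\<lambda>\<omega>. (tr (X 1 \<omega>))\<^sup>2) / b\<^sup>2"
  proof -
    have "prob {\<omega>\<in>space M. \<exists>k\<le>n. b \<le> \<bar>\<Sum>i=1..k. W i \<omega>\<bar>}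
        \<le> (\<Sum>i=1..n. expectation (\<lambda>\<omega>. (W i \<omega>)\<^sup>2)) / b\<^sup>2"
      using indep b int_tr int_tr2 mean_tr
      by (intro kolmogorov_maximal_inequality) (auto simp: eqW2, auto simp: W_def prob_space)
    also have "\<dots> \<le> (\<Sum>i=1..n. expectation (\<lambda>\<omega>. (tr (X 1 \<omega>))\<^sup>2)) / b\<^sup>2"
    proof (intro divide_right_mono sum_mono)
      fix i assume "i \<in> {1..n}"
      then have i: "1 \<le> i" by simp
      have "expectation (\<lambda>\<omega>. (W i \<omega>)\<^sup>2)
          = expectation (\<lambda>\<omega>. (tr (X i \<omega>))\<^sup>2) - 2 * \<mu> * expectation (\<lambda>\<omega>. tr (X i \<omega>)) + \<mu>\<^sup>2"
        unfolding eqW2 using int_tr[OF i] int_tr2[OF i] by (simp add: prob_space)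
      also have "\<dots> = expectation (\<lambda>\<omega>. (tr (X 1 \<omega>))\<^sup>2) - \<mu>\<^sup>2"
        unfolding mean_tr[OF i] mean_tr2[OF i] by (simp add: power2_eq_square)
      also have "\<dots> \<le> expectation (\<lambda>\<omega>. (tr (X 1 \<omega>))\<^sup>2)" by simp
      finally show "expectation (\<lambda>\<omega>. (W i \<omega>)\<^sup>2) \<le> expectation (\<lambda>\<omega>. (tr (X 1 \<omega>))\<^sup>2)" .
    qed simp
    finally show ?thesis by simp
  qed
  define J where "J = {\<omega>\<in>space M. c < \<bar>X 1 \<omega>\<bar> powr q}"
  have [measurable]: "J \<in> sets M" unfolding J_def by measurable
  have jumps: "prob (\<Union>i\<in>{1..n}. {\<omega>\<in>space M. c < \<bar>X i \<omega>\<bar> powr q}) \<le> real n * prob J"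
  proof -
    have meas: "{\<omega>\<in>space M. c < \<bar>X i \<omega>\<bar> powr q} \<in> sets M" if "i \<in> {1..n}" for i
    proof -
      have [measurable]: "X i \<in> borel_measurable M" using that by simp
      show ?thesis by measurable
    qed
    have "prob (\<Union>i\<in>{1..n}. {\<omega>\<in>space M. c < \<bar>X i \<omega>\<bar> powr q})
        \<le> (\<Sum>i\<in>{1..n}. prob {\<omega>\<in>space M. c < \<bar>X i \<omega>\<bar> powr q})"
      using meas by (intro finite_measure_subadditive_finite) auto
    also have "\<dots> = (\<Sum>i\<in>{1..n}. prob J)"
    proof (rule sum.cong)
      fix i assume "i \<in> {1..n}"
      moreover have "{x::real. c < \<bar>x\<bar> powr q} \<in> sets borel" by measurable
      ultimately show "prob {\<omega>\<in>space M. c < \<bar>X i \<omega>\<bar> powr q} = prob J"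
        using prob_X[of i "{x. c < \<bar>x\<bar> powr q}"] by (simp add: J_def)
    qed simp
    finally show ?thesis by simp
  qed
  have sub: "{\<omega>\<in>space M. \<exists>k\<le>n. c powr (1 / q) / 2 < \<bar>partial_sum X k \<omega>\<bar>}
      \<subseteq> (\<Union>i\<in>{1..n}. {\<omega>\<in>space M. c < \<bar>X i \<omega>\<bar> powr q})
        \<union> {\<omega>\<in>space M. \<exists>k\<le>n. b \<le> \<bar>\<Sum>i=1..k. W i \<omega>\<bar>}" (is "?A \<subseteq> ?B \<union> ?C")
  proof
    fix \<omega> assume "\<omega> \<in> ?A"
    then obtain k where \<omega>: "\<omega> \<in> space M" and k: "k \<le> n" "2 * b < \<bar>partial_sum X k \<omega>\<bar>"
      by (auto simp: b_def)
    show "\<omega> \<in> ?B \<union> ?C"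
    proof (cases "\<omega> \<in> ?B")
      case False
      then have "tr (X i \<omega>) = X i \<omega>" if "i \<in> {1..k}" for i
        using that \<omega> k by (force simp: tr_def)
      then have "partial_sum X k \<omega> = (\<Sum>i=1..k. W i \<omega>) + real k * \<mu>"
        by (simp add: partial_sum_def W_def sum_subtractf)
      moreover have "\<bar>real k * \<mu>\<bar> \<le> real n * \<bar>\<mu>\<bar>"
        using k by (simp add: abs_mult mult_right_mono)
      ultimately have "b \<le> \<bar>\<Sum>i=1..k. W i \<omega>\<bar>" using k drift' by linarith
      then show ?thesis using k \<omega> by auto
    qed simp
  qed
  have mW: "(\<lambda>\<omega>. \<Sum>i=1..k. W i \<omega>) \<in> borel_measurable M" for k
  proof (intro borel_measurable_sum)
    fix i assume "i \<in> {1..k}"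
    then have [measurable]: "X i \<in> borel_measurable M" by simp
    show "W i \<in> borel_measurable M" unfolding W_def by measurable
  qed
  have meas: "?B \<in> sets M" "?C \<in> sets M"
  proof -
    show "?B \<in> sets M"
    proof (intro sets.finite_UN)
      fix i assume "i \<in> {1..n}"
      then have [measurable]: "X i \<in> borel_measurable M" by simp
      show "{\<omega>\<in>space M. c < \<bar>X i \<omega>\<bar> powr q} \<in> sets M" by measurable
    qed simp
    show "?C \<in> sets M" using mW by measurable
  qed
  have int1: "integrable M (\<lambda>\<omega>. real n * indicator J \<omega>)"
    by (intro integrable_mult_right integrable_real_indicator) (simp_all add: emeasure_eq_measure)
  have int2: "integrable M (\<lambda>\<omega>. 16 * real n * c powr (- 2 / q) * (tr (X 1 \<omega>))\<^sup>2)"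
    by (intro integrable_mult_right int_tr2) simp
  have "emeasure M ?A \<le> emeasure M (?B \<union> ?C)"
    by (rule emeasure_mono[OF sub sets.Un[OF meas]])
  also have "\<dots> = ennreal (prob (?B \<union> ?C))" by (rule emeasure_eq_measure)
  also have "\<dots> \<le> ennreal (real n * prob J + real n * expectation (\<lambda>\<omega>. (tr (X 1 \<omega>))\<^sup>2) / b\<^sup>2)"
    using measure_Un_le[OF meas] jumps kol by (intro ennreal_leI) linarith
  also have "\<dots> = ennreal (expectation (\<lambda>\<omega>. real n * indicator J \<omega>
      + 16 * real n * c powr (- 2 / q) * (tr (X 1 \<omega>))\<^sup>2))"
  proof -
    have b2: "1 / b\<^sup>2 = 16 * c powr (- 2 / q)"
      using c by (simp add: b_def power2_eq_square powr_add[symmetric] powr_minus field_simps)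
    have "real n * expectation (\<lambda>\<omega>. (tr (X 1 \<omega>))\<^sup>2) / b\<^sup>2
        = real n * expectation (\<lambda>\<omega>. (tr (X 1 \<omega>))\<^sup>2) * (1 / b\<^sup>2)" by simp
    also have "\<dots> = 16 * real n * c powr (- 2 / q) * expectation (\<lambda>\<omega>. (tr (X 1 \<omega>))\<^sup>2)"
      unfolding b2 by (simp only: mult_ac)
    finally have "real n * expectation (\<lambda>\<omega>. (tr (X 1 \<omega>))\<^sup>2) / b\<^sup>2
        = 16 * real n * c powr (- 2 / q) * expectation (\<lambda>\<omega>. (tr (X 1 \<omega>))\<^sup>2)" .
    then have "real n * prob J + real n * expectation (\<lambda>\<omega>. (tr (X 1 \<omega>))\<^sup>2) / b\<^sup>2
        = expectation (\<lambda>\<omega>. real n * indicator J \<omega>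
          + 16 * real n * c powr (- 2 / q) * (tr (X 1 \<omega>))\<^sup>2)"
      by (subst Bochner_Integration.integral_add[OF int1 int2]) simp
    then show ?thesis by (simp only:)
  qed
  also have "\<dots> = (\<integral>\<^sup>+\<omega>. ennreal (real n * indicator J \<omega>
      + 16 * real n * c powr (- 2 / q) * (tr (X 1 \<omega>))\<^sup>2) \<partial>M)"
    by (rule nn_integral_eq_integral[symmetric, OF Bochner_Integration.integrable_add[OF int1 int2]])
      (intro AE_I2 add_nonneg_nonneg mult_nonneg_nonneg, simp_all)
  also have "\<dots> = (\<integral>\<^sup>+\<omega>. ennreal (real n * (if c < \<bar>X 1 \<omega>\<bar> powr q then 1 else 0)
      + 16 * real n * c powr (- 2 / q) * (if \<bar>X 1 \<omega>\<bar> powr q \<le> c then (X 1 \<omega>)\<^sup>2 else 0)) \<partial>M)"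
    by (intro nn_integral_cong) (auto simp: J_def tr_def)
  finally show ?thesis .
qed

end

section \<open>Summation of the tail probabilities\<close>

context centred_iid begin

definition block_excess :: "real \<Rightarrow> nat \<Rightarrow> 'a set" where
  "block_excess q i = {\<omega>\<in>space M. \<exists>k\<in>{2 ^ i..<2 ^ Suc i}. threshold q k < \<bar>partial_sum X k \<omega>\<bar>}"

definition tail_excess :: "real \<Rightarrow> nat \<Rightarrow> 'a set" where
  "tail_excess q m = {\<omega>\<in>space M. \<exists>k\<ge>m. threshold q k < \<bar>partial_sum X k \<omega>\<bar>}"

lemma measurable_partial_sum [measurable]: "partial_sum X k \<in> borel_measurable M"
  unfolding partial_sum_def[abs_def] by (intro borel_measurable_sum measurable_X) simp

lemma measurable_excess [measurable]:
  "block_excess q i \<in> sets M" "tail_excess q m \<in> sets M"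
  unfolding block_excess_def tail_excess_def by measurable

lemma block_excess_bound:
  fixes q :: real
  assumes q: "1 \<le> q"
    and drift: "(\<integral>\<^sup>+\<omega>. ennreal (if 2 ^ i < \<bar>X 1 \<omega>\<bar> powr q then \<bar>X 1 \<omega>\<bar> powr q else 0) \<partial>M)
      \<le> ennreal (1 / 8)"
  shows "emeasure M (block_excess q i) \<le> (\<integral>\<^sup>+\<omega>. ennreal (block_cost q i (X 1 \<omega>)) \<partial>M)"
proof -
  have "block_excess q i
      \<subseteq> {\<omega>\<in>space M. \<exists>k\<le>2 ^ Suc i. (2 ^ i) powr (1 / q) / 2 < \<bar>partial_sum X k \<omega>\<bar>}"
  proof
    fix \<omega> assume "\<omega> \<in> block_excess q i"
    then obtain k where k: "\<omega> \<in> space M" "2 ^ i \<le> k" "k < 2 ^ Suc i"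
      "threshold q k < \<bar>partial_sum X k \<omega>\<bar>"
      by (auto simp: block_excess_def)
    have "2 ^ i \<le> real k" using k(2) by (metis of_nat_le_iff of_nat_numeral of_nat_power)
    then have "(2 ^ i) powr (1 / q) \<le> real k powr (1 / q)"
      using q by (intro powr_mono2) auto
    then show "\<omega> \<in> {\<omega>\<in>space M. \<exists>k\<le>2 ^ Suc i. (2 ^ i) powr (1 / q) / 2 < \<bar>partial_sum X k \<omega>\<bar>}"
      using k by (auto simp: threshold_def intro!: exI[of _ k])
  qed
  then have "emeasure M (block_excess q i)
      \<le> emeasure M {\<omega>\<in>space M. \<exists>k\<le>2 ^ Suc i. (2 ^ i) powr (1 / q) / 2 < \<bar>partial_sum X k \<omega>\<bar>}"
    by (rule emeasure_mono) measurable
  also have "\<dots> \<le> (\<integral>\<^sup>+\<omega>. ennreal (real (2 ^ Suc i) * (if 2 ^ i < \<bar>X 1 \<omega>\<bar> powr q then 1 else 0)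
      + 16 * real (2 ^ Suc i) * (2 ^ i) powr (- 2 / q)
        * (if \<bar>X 1 \<omega>\<bar> powr q \<le> 2 ^ i then (X 1 \<omega>)\<^sup>2 else 0)) \<partial>M)"
    using q drift by (intro partial_sum_tail) auto
  also have "\<dots> = (\<integral>\<^sup>+\<omega>. ennreal (block_cost q i (X 1 \<omega>)) \<partial>M)"
  proof (intro nn_integral_cong arg_cong[of _ _ ennreal])
    fix \<omega>
    have "(2 ^ i) * (2 ^ i) powr (- 2 / q) = (2 ^ i) powr (1 - 2 / q)"
      by (simp add: powr_diff powr_minus field_simps)
    also have "\<dots> = (2 powr (- (2 / q - 1))) ^ i"
      by (simp add: powr_powr powr_realpow[symmetric] mult.commute)
    finally have r: "(2 ^ i) * (2 ^ i) powr (- 2 / q) = (2 powr (- (2 / q - 1))) ^ i" .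
    have x: "(X 1 \<omega>)\<^sup>2 = (\<bar>X 1 \<omega>\<bar> powr q) powr (1 + (2 / q - 1))"
      using q by (cases "X 1 \<omega> = 0") (auto simp: powr_powr powr_numeral)
    show "real (2 ^ Suc i) * (if 2 ^ i < \<bar>X 1 \<omega>\<bar> powr q then 1 else 0)
      + 16 * real (2 ^ Suc i) * (2 ^ i) powr (- 2 / q)
        * (if \<bar>X 1 \<omega>\<bar> powr q \<le> 2 ^ i then (X 1 \<omega>)\<^sup>2 else 0) = block_cost q i (X 1 \<omega>)"
      unfolding block_cost_def r[symmetric] x[symmetric] by simp
  qed
  finally show ?thesis .
qed

text \<open>On \<open>\<bar>X 1\<bar> powr q > 2^i\<close> the index \<open>i\<close> is at most a multiple of the logarithm in the integrand;
  multiply the failed drift condition by \<open>8 i\<close>.\<close>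

lemma drift_level_bound:
  fixes q :: real
  assumes drift: "\<not> (\<integral>\<^sup>+\<omega>. ennreal (if 2 ^ i < \<bar>X 1 \<omega>\<bar> powr q then \<bar>X 1 \<omega>\<bar> powr q else 0) \<partial>M)
      \<le> ennreal (1 / 8)"
  shows "of_nat i \<le> 16 * (\<integral>\<^sup>+\<omega>. ennreal (\<bar>X 1 \<omega>\<bar> powr q * ln (38 * \<bar>X 1 \<omega>\<bar> powr q + 1)) \<partial>M)"
proof -
  let ?f = "\<lambda>\<omega>. if 2 ^ i < \<bar>X 1 \<omega>\<bar> powr q then \<bar>X 1 \<omega>\<bar> powr q else 0"
  have "of_nat i = ennreal (8 * real i) * ennreal (1 / 8)"
    by (simp add: ennreal_mult[symmetric] ennreal_of_nat_eq_real_of_nat)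
  also have "\<dots> \<le> ennreal (8 * real i) * (\<integral>\<^sup>+\<omega>. ennreal (?f \<omega>) \<partial>M)"
    using drift by (intro mult_left_mono) auto
  also have "\<dots> = (\<integral>\<^sup>+\<omega>. ennreal (8 * real i) * ennreal (?f \<omega>) \<partial>M)"
    by (intro nn_integral_cmult[symmetric]) measurable
  also have "\<dots> \<le> (\<integral>\<^sup>+\<omega>. 16 * ennreal (\<bar>X 1 \<omega>\<bar> powr q * ln (38 * \<bar>X 1 \<omega>\<bar> powr q + 1)) \<partial>M)"
  proof (rule nn_integral_mono)
    fix \<omega>
    let ?z = "\<bar>X 1 \<omega>\<bar> powr q"
    have "8 * real i * ?f \<omega> \<le> 16 * (?z * ln (38 * ?z + 1))"
      using index_le_log_weight[of i ?z] mult_left_mono[of "real i" "2 * ln (38 * ?z + 1)" "8 * ?z"]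
      by (simp add: algebra_simps)
    then show "ennreal (8 * real i) * ennreal (?f \<omega>) \<le> 16 * ennreal (?z * ln (38 * ?z + 1))"
      using ennreal_leI[of "8 * real i * ?f \<omega>" "16 * (?z * ln (38 * ?z + 1))"]
      by (simp add: ennreal_mult)
  qed
  also have "\<dots> = 16 * (\<integral>\<^sup>+\<omega>. ennreal (\<bar>X 1 \<omega>\<bar> powr q * ln (38 * \<bar>X 1 \<omega>\<bar> powr q + 1)) \<partial>M)"
    by (intro nn_integral_cmult) measurable
  finally show ?thesis .
qed

text \<open>Levels \<open>j \<le> 16 L\<close>, where the drift may be too large, are counted with probability one. Beyond
  them every later block satisfies the drift condition, so the union bound over blocks is
  affordable.\<close>

lemma sum_dyadic_tail_excess:
  fixes q :: real
  assumes q: "1 \<le> q" "q < 2"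
  shows "(\<Sum>j. ennreal (prob (tail_excess q (2 ^ Suc j))))
    \<le> ennreal (4 * q / (2 - q)\<^sup>2) + ennreal (792 * q / (2 - q)\<^sup>2)
      * (\<integral>\<^sup>+\<omega>. ennreal (\<bar>X 1 \<omega>\<bar> powr q * ln (38 * \<bar>X 1 \<omega>\<bar> powr q + 1)) \<partial>M)"
proof -
  define L where "L = (\<integral>\<^sup>+\<omega>. ennreal (\<bar>X 1 \<omega>\<bar> powr q * ln (38 * \<bar>X 1 \<omega>\<bar> powr q + 1)) \<partial>M)"
  define p where "p i = (\<integral>\<^sup>+\<omega>. ennreal (block_cost q i (X 1 \<omega>)) \<partial>M)" for i
  have each: "ennreal (prob (tail_excess q (2 ^ Suc j)))
      \<le> (if of_nat (Suc j) \<le> 16 * L then 1 else 0) + (\<Sum>i. if Suc j \<le> i then p i else 0)" for j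
  proof (cases "of_nat (Suc j) \<le> 16 * L")
    case True
    have "ennreal (prob (tail_excess q (2 ^ Suc j))) \<le> 1" by simp
    then show ?thesis using True by (simp add: add_increasing2)
  next
    case False
    have sub: "tail_excess q (2 ^ Suc j) \<subseteq> (\<Union>i. if Suc j \<le> i then block_excess q i else {})"
    proof
      fix \<omega> assume "\<omega> \<in> tail_excess q (2 ^ Suc j)"
      then obtain k where k: "\<omega> \<in> space M" "2 ^ Suc j \<le> k" "threshold q k < \<bar>partial_sum X k \<omega>\<bar>"
        by (auto simp: tail_excess_def)
      have "0 < k" using k(2) by (metis gr0I not_le power_eq_0_iff zero_less_power zero_less_numeral)
      then obtain i where i: "2 ^ i \<le> k" "k < 2 ^ Suc i"
        using ex_power_ivl1[of 2 k] by auto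
      have "2 ^ Suc j < (2::nat) ^ Suc i" using k(2) i(2) by linarith
      then have "Suc j \<le> i" by simp
      moreover have "\<omega> \<in> block_excess q i"
        unfolding block_excess_def using k i by auto
      ultimately show "\<omega> \<in> (\<Union>i. if Suc j \<le> i then block_excess q i else {})" by auto
    qed
    have "emeasure M (tail_excess q (2 ^ Suc j))
        \<le> emeasure M (\<Union>i. if Suc j \<le> i then block_excess q i else {})"
      using sub by (rule emeasure_mono) auto
    also have "\<dots> \<le> (\<Sum>i. emeasure M (if Suc j \<le> i then block_excess q i else {}))"
      by (rule emeasure_subadditive_countably) auto
    also have "\<dots> \<le> (\<Sum>i. if Suc j \<le> i then p i else 0)"
    proof (intro suminf_le summableI)
      fix i
      show "emeasure M (if Suc j \<le> i then block_excess q i else {}) \<le> (if Suc j \<le> i then p i else 0)"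
      proof (cases "Suc j \<le> i")
        case True
        then have "\<not> of_nat i \<le> 16 * L"
          using False by (meson of_nat_mono order_trans)
        then have "(\<integral>\<^sup>+\<omega>. ennreal (if 2 ^ i < \<bar>X 1 \<omega>\<bar> powr q then \<bar>X 1 \<omega>\<bar> powr q else 0) \<partial>M)
            \<le> ennreal (1 / 8)"
          using drift_level_bound[of i q] unfolding L_def by blast
        then show ?thesis using True block_excess_bound[OF q(1)] by (simp add: p_def)
      qed simp
    qed
    finally show ?thesis using False by (simp add: emeasure_eq_measure)
  qed
  have cost: "(\<Sum>i. of_nat i * p i)
      \<le> ennreal (4 * q / (2 - q)\<^sup>2) + ennreal (776 * q / (2 - q)\<^sup>2) * L"
  proof -
    have "(\<Sum>i. of_nat i * p i) = (\<integral>\<^sup>+\<omega>. (\<Sum>i. of_nat i * ennreal (block_cost q i (X 1 \<omega>))) \<partial>M)"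
      unfolding p_def by (subst nn_integral_suminf) (simp_all add: nn_integral_cmult)
    also have "\<dots> \<le> (\<integral>\<^sup>+\<omega>. ennreal (4 * q / (2 - q)\<^sup>2) + ennreal (776 * q / (2 - q)\<^sup>2)
        * ennreal (\<bar>X 1 \<omega>\<bar> powr q * ln (38 * \<bar>X 1 \<omega>\<bar> powr q + 1)) \<partial>M)"
      using q by (intro nn_integral_mono weighted_cost_bound) auto
    also have "\<dots> = ennreal (4 * q / (2 - q)\<^sup>2) + ennreal (776 * q / (2 - q)\<^sup>2) * L"
      unfolding L_def by (simp add: nn_integral_add nn_integral_cmult emeasure_space_1)
    finally show ?thesis .
  qed
  have "(\<Sum>j. ennreal (prob (tail_excess q (2 ^ Suc j))))
      \<le> (\<Sum>j. (if of_nat (Suc j) \<le> 16 * L then 1 else 0) + (\<Sum>i. if Suc j \<le> i then p i else 0))"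
    by (intro suminf_le summableI each)
  also have "\<dots> = (\<Sum>j. if of_nat (Suc j) \<le> 16 * L then 1 else 0)
      + (\<Sum>j. \<Sum>i. if Suc j \<le> i then p i else 0)"
    by (rule suminf_add[symmetric]) (rule summableI)+
  also have "\<dots> \<le> 16 * L + (ennreal (4 * q / (2 - q)\<^sup>2) + ennreal (776 * q / (2 - q)\<^sup>2) * L)"
    unfolding suminf_tails_swap by (intro add_mono suminf_indicator_levels cost)
  also have "\<dots>
      \<le> ennreal (4 * q / (2 - q)\<^sup>2) + ennreal (792 * q / (2 - q)\<^sup>2) * L"
  proof -
    \<comment> \<open>\<open>792 = 16 + 776\<close>: the unweighted \<open>16 * L\<close> is absorbed because \<open>q / (2 - q)\<^sup>2 \<ge> 1\<close>\<close>
    have "16 * 1 + 776 * (q / (2 - q)\<^sup>2) \<le> 16 * (q / (2 - q)\<^sup>2) + 776 * (q / (2 - q)\<^sup>2)"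
      using one_le_ratio[OF q] by (intro add_mono mult_left_mono) auto
    then have "16 + 776 * q / (2 - q)\<^sup>2 \<le> 792 * q / (2 - q)\<^sup>2" by simp
    then have "ennreal (16 + 776 * q / (2 - q)\<^sup>2) * L \<le> ennreal (792 * q / (2 - q)\<^sup>2) * L"
      by (intro mult_right_mono ennreal_leI) auto
    moreover have "ennreal (16 + 776 * q / (2 - q)\<^sup>2) = 16 + ennreal (776 * q / (2 - q)\<^sup>2)"
      using q by (subst ennreal_plus) auto
    ultimately show ?thesis by (simp add: distrib_right add_ac add_left_mono)
  qed
  finally show ?thesis unfolding L_def .
qed

lemma sum_tail_excess:
  fixes q :: real
  assumes q: "1 \<le> q" "q < 2"
  shows "(\<Sum>m. ennreal (prob (tail_excess q (Suc m)) / real (Suc m)))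
    \<le> 1 + ennreal (4 * q / (2 - q)\<^sup>2) + ennreal (792 * q / (2 - q)\<^sup>2)
      * (\<integral>\<^sup>+\<omega>. ennreal (\<bar>X 1 \<omega>\<bar> powr q * ln (38 * \<bar>X 1 \<omega>\<bar> powr q + 1)) \<partial>M)"
proof -
  have "(\<Sum>m. ennreal (prob (tail_excess q (Suc m)) / real (Suc m)))
      \<le> (\<Sum>j. ennreal (prob (tail_excess q (2 ^ j))))"
  proof (rule dyadic_condensation)
    fix m n :: nat assume "m \<le> n"
    then have "tail_excess q n \<subseteq> tail_excess q m"
      unfolding tail_excess_def by (blast intro: order_trans)
    then show "prob (tail_excess q n) \<le> prob (tail_excess q m)" by (rule finite_measure_mono) simp
  qed simp
  also have "\<dots> = ennreal (prob (tail_excess q 1)) + (\<Sum>j. ennreal (prob (tail_excess q (2 ^ Suc j))))"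
    by (subst suminf_offset[where i=1, OF summableI]) (simp add: add.commute)
  also have "\<dots> \<le> 1 + (ennreal (4 * q / (2 - q)\<^sup>2) + ennreal (792 * q / (2 - q)\<^sup>2)
      * (\<integral>\<^sup>+\<omega>. ennreal (\<bar>X 1 \<omega>\<bar> powr q * ln (38 * \<bar>X 1 \<omega>\<bar> powr q + 1)) \<partial>M))"
    using q by (intro add_mono sum_dyadic_tail_excess) auto
  finally show ?thesis by (simp add: add_ac)
qed

lemma tail_sup_prob_le:
  fixes q :: real
  assumes "1 \<le> m"
  shows "tail_sup_prob M X q 1 m \<le> prob (tail_excess q m)"
  unfolding tail_sup_prob_def
proof (rule finite_measure_mono)
  show "{\<omega>\<in>space M. ereal 1 \<le> (SUP k\<in>{m..}. ereal \<bar>real k powr (- 1 / q) * partial_sum X k \<omega>\<bar>)}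
      \<subseteq> tail_excess q m"
  proof safe
    fix \<omega> assume \<omega>: "\<omega> \<in> space M"
      and sup: "ereal 1 \<le> (SUP k\<in>{m..}. ereal \<bar>real k powr (- 1 / q) * partial_sum X k \<omega>\<bar>)"
    have "ereal (1 / 2) < ereal 1" by simp
    with sup have "ereal (1 / 2) < (SUP k\<in>{m..}. ereal \<bar>real k powr (- 1 / q) * partial_sum X k \<omega>\<bar>)"
      by (rule less_le_trans[rotated])
    then obtain k where k: "m \<le> k" "1 / 2 < \<bar>real k powr (- 1 / q) * partial_sum X k \<omega>\<bar>"
      by (auto simp: less_SUP_iff)
    have "0 < real k" using k(1) assms by simp
    then have "threshold q k < \<bar>partial_sum X k \<omega>\<bar>"
      using k(2) by (simp add: threshold_def abs_mult powr_minus field_simps)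
    then show "\<omega> \<in> tail_excess q m" using k(1) \<omega> by (auto simp: tail_excess_def)
  qed
qed simp

end

section \<open>Scaling\<close>

lemma centred_iid_scaled:
  assumes "prob_space M" "iid_seq M X" "\<And>n. n \<ge> 1 \<Longrightarrow> integrable M (X n)"
    "integral\<^sup>L M (X 1) = 0"
  shows "centred_iid M (\<lambda>n \<omega>. X n \<omega> / \<epsilon>)"
proof -
  interpret prob_space M by fact
  have [measurable]: "random_variable borel (X n)" if "1 \<le> n" for n using assms(3)[OF that] by simp
  show ?thesis
  proof
    show "iid_seq M (\<lambda>n \<omega>. X n \<omega> / \<epsilon>)"
      unfolding iid_seq_def
    proof (intro conjI allI impI)
      have "indep_vars (\<lambda>_. borel) X {1..}" using assms(2) by (simp add: iid_seq_def)
      then show "indep_vars (\<lambda>_. borel) (\<lambda>n \<omega>. X n \<omega> / \<epsilon>) {1..}"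
        by (rule indep_vars_compose2) measurable
      fix n :: nat assume n: "1 \<le> n"
      have eq: "distr M borel (\<lambda>\<omega>. X n \<omega> / \<epsilon>) = distr (distr M borel (X n)) borel (\<lambda>x. x / \<epsilon>)"
        if "1 \<le> n" for n
        using assms(3)[OF that] by (subst distr_distr) (auto simp: comp_def)
      have "distr M borel (X n) = distr M borel (X 1)"
        using assms(2) n unfolding iid_seq_def by blast
      then show "distr M borel (\<lambda>\<omega>. X n \<omega> / \<epsilon>) = distr M borel (\<lambda>\<omega>. X 1 \<omega> / \<epsilon>)"
        using eq[OF n] eq[of 1] by (simp only: order_refl)
    qed
  next
    show "integrable M (\<lambda>\<omega>. X n \<omega> / \<epsilon>)" if "1 \<le> n" for n
      using assms(3)[OF that] by simp
    show "expectation (\<lambda>\<omega>. X 1 \<omega> / \<epsilon>) = 0" using assms(4) by simp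
  qed
qed

lemma tail_sup_prob_scale:
  assumes "0 < \<epsilon>"
  shows "tail_sup_prob M X q \<epsilon> m = tail_sup_prob M (\<lambda>n \<omega>. X n \<omega> / \<epsilon>) q 1 m"
proof -
  have "ereal \<epsilon> \<le> (SUP k\<in>{m..}. ereal \<bar>real k powr (- 1 / q) * partial_sum X k \<omega>\<bar>)
    \<longleftrightarrow> ereal 1 \<le> (SUP k\<in>{m..}. ereal \<bar>real k powr (- 1 / q) * partial_sum (\<lambda>n \<omega>. X n \<omega> / \<epsilon>) k \<omega>\<bar>)"
    for \<omega>
  proof -
    have "ereal \<bar>real k powr (- 1 / q) * partial_sum X k \<omega>\<bar>
        = ereal \<epsilon> * ereal \<bar>real k powr (- 1 / q) * partial_sum (\<lambda>n \<omega>. X n \<omega> / \<epsilon>) k \<omega>\<bar>" for k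
      using assms by (simp add: partial_sum_def sum_divide_distrib[symmetric] abs_mult)
    then have "(SUP k\<in>{m..}. ereal \<bar>real k powr (- 1 / q) * partial_sum X k \<omega>\<bar>)
        = ereal \<epsilon> * (SUP k\<in>{m..}. ereal \<bar>real k powr (- 1 / q) * partial_sum (\<lambda>n \<omega>. X n \<omega> / \<epsilon>) k \<omega>\<bar>)"
      using assms by (simp add: Sup_ereal_mult_left')
    then show ?thesis
      using assms ereal_mult_le_mult_iff[of "ereal \<epsilon>" "ereal 1"] by simp
  qed
  then show ?thesis by (simp add: tail_sup_prob_def)
qed

theorem proposition4p1:
  fixes M :: "'a measure" and X :: "nat \<Rightarrow> 'a \<Rightarrow> real" and q \<epsilon> c\<^sub>q :: real
  assumes "prob_space M"
    and "iid_seq M X"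
    and "\<And>n. n \<ge> 1 \<Longrightarrow> integrable M (X n)"
    and "integral\<^sup>L M (X 1) = 0"
    and "1 \<le> q" and "q < 2"
    and "\<epsilon> > 0"
    and "c\<^sub>q = 4 / (2 - q)"
  shows "(\<Sum>m. ennreal (tail_sup_prob M X q \<epsilon> (Suc m) / real (Suc m)))
    \<le> 1 + ennreal (c\<^sub>q / (exp 1 * ln (2 powr (1 / q - 1 / 2))))
      + ennreal (2603 * q)
          * (\<integral>\<^sup>+\<omega>. ennreal (\<bar>X 1 \<omega>\<bar> powr q * ln (38 * \<bar>X 1 \<omega>\<bar> powr q / \<epsilon> powr q + 1)) \<partial>M)
          / ennreal ((2 - q)\<^sup>2 * min (\<epsilon>\<^sup>2) 1)"
proof -
  define Y where "Y n \<omega> = X n \<omega> / \<epsilon>" for n \<omega>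
  interpret Y: centred_iid M Y
    unfolding Y_def[abs_def] using assms(1-4) by (rule centred_iid_scaled)
  have [measurable]: "X 1 \<in> borel_measurable M"
    using assms(3)[of 1] by (rule borel_measurable_integrable) simp
  define c where "c = 792 * q / (2 - q)\<^sup>2"
  define d where "d = (2 - q)\<^sup>2 * min (\<epsilon>\<^sup>2) 1"
  have c: "0 \<le> c" and d: "0 < d" using assms(5-7) by (auto simp: c_def d_def)
  \<comment> \<open>the right-hand side equals \<open>8 * q / ((2 - q)\<^sup>2 * exp 1 * ln 2)\<close>\<close>
  have main: "4 * q / (2 - q)\<^sup>2 \<le> c\<^sub>q / (exp 1 * ln (2 powr (1 / q - 1 / 2)))"
  proof -
    have "exp 1 * ln 2 \<le> 272 / 100 * (25 / 36 :: real)"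
      using e_less_272 ln2_le_25_over_36 by (intro mult_mono) auto
    then have e: "exp 1 * ln 2 \<le> (2 :: real)" by simp
    have "4 * q / (2 - q)\<^sup>2 = 8 * q / (2 - q)\<^sup>2 / 2" by simp
    also have "\<dots> \<le> 8 * q / (2 - q)\<^sup>2 / (exp 1 * ln 2)"
      using e assms(5,6) by (intro divide_left_mono) auto
    also have "\<dots> = c\<^sub>q / (exp 1 * ((1 / q - 1 / 2) * ln 2))"
      using assms(5,6) by (simp add: assms(8) power2_eq_square divide_simps)
    also have "(1 / q - 1 / 2) * ln 2 = ln (2 powr (1 / q - 1 / 2))" by (simp add: ln_powr)
    finally show ?thesis .
  qed
  have eps: "min (\<epsilon>\<^sup>2) 1 \<le> \<epsilon> powr q"
  proof (cases "\<epsilon> \<le> 1")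
    case True
    then have "\<epsilon> powr 2 \<le> \<epsilon> powr q" using assms(6,7) by (intro powr_mono') auto
    then show ?thesis using assms(7) by (simp add: powr_numeral)
  next
    case False
    then show ?thesis using assms(5) ge_one_powr_ge_zero[of \<epsilon> q] by simp
  qed
  have "c \<le> 2603 * q / d * \<epsilon> powr q"
  proof -
    have "c * d \<le> 792 * q * min (\<epsilon>\<^sup>2) 1"
      using assms(5,6) by (simp add: c_def d_def)
    also have "\<dots> \<le> 2603 * q * \<epsilon> powr q"
      using assms(5) eps assms(7) by (intro mult_mono) auto
    finally show ?thesis using d by (simp add: field_simps)
  qed
  then have coeff: "c * (\<bar>Y 1 \<omega>\<bar> powr q * ln (38 * \<bar>Y 1 \<omega>\<bar> powr q + 1))
      \<le> 2603 * q / d * (\<bar>X 1 \<omega>\<bar> powr q * ln (38 * \<bar>X 1 \<omega>\<bar> powr q / \<epsilon> powr q + 1))" for \<omega>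
  proof -
    have x: "\<bar>Y 1 \<omega>\<bar> powr q = \<bar>X 1 \<omega>\<bar> powr q / \<epsilon> powr q"
      using assms(7) by (simp add: Y_def powr_divide)
    have "c * (\<bar>Y 1 \<omega>\<bar> powr q * ln (38 * \<bar>Y 1 \<omega>\<bar> powr q + 1))
        \<le> 2603 * q / d * \<epsilon> powr q * (\<bar>Y 1 \<omega>\<bar> powr q * ln (38 * \<bar>Y 1 \<omega>\<bar> powr q + 1))"
      using \<open>c \<le> _\<close> by (intro mult_right_mono) auto
    then show ?thesis using assms(7) by (simp add: x[unfolded One_nat_def])
  qed
  have "ennreal c * (\<integral>\<^sup>+\<omega>. ennreal (\<bar>Y 1 \<omega>\<bar> powr q * ln (38 * \<bar>Y 1 \<omega>\<bar> powr q + 1)) \<partial>M)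
      = (\<integral>\<^sup>+\<omega>. ennreal (c * (\<bar>Y 1 \<omega>\<bar> powr q * ln (38 * \<bar>Y 1 \<omega>\<bar> powr q + 1))) \<partial>M)"
  proof -
    have "ennreal (c * (\<bar>Y 1 \<omega>\<bar> powr q * ln (38 * \<bar>Y 1 \<omega>\<bar> powr q + 1)))
        = ennreal c * ennreal (\<bar>Y 1 \<omega>\<bar> powr q * ln (38 * \<bar>Y 1 \<omega>\<bar> powr q + 1))" for \<omega>
      using c by (intro ennreal_mult) auto
    then show ?thesis by (simp only:) (intro nn_integral_cmult[symmetric], measurable)
  qed
  also have "\<dots> \<le> (\<integral>\<^sup>+\<omega>. ennreal (2603 * q / d
      * (\<bar>X 1 \<omega>\<bar> powr q * ln (38 * \<bar>X 1 \<omega>\<bar> powr q / \<epsilon> powr q + 1))) \<partial>M)"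
    by (intro nn_integral_mono ennreal_leI coeff)
  also have "\<dots> = ennreal (2603 * q / d)
      * (\<integral>\<^sup>+\<omega>. ennreal (\<bar>X 1 \<omega>\<bar> powr q * ln (38 * \<bar>X 1 \<omega>\<bar> powr q / \<epsilon> powr q + 1)) \<partial>M)"
  proof -
    have "ennreal (2603 * q / d * (\<bar>X 1 \<omega>\<bar> powr q * ln (38 * \<bar>X 1 \<omega>\<bar> powr q / \<epsilon> powr q + 1)))
        = ennreal (2603 * q / d)
          * ennreal (\<bar>X 1 \<omega>\<bar> powr q * ln (38 * \<bar>X 1 \<omega>\<bar> powr q / \<epsilon> powr q + 1))" for \<omega>
      using d assms(5) by (intro ennreal_mult) auto
    then show ?thesis by (simp only:) (intro nn_integral_cmult, measurable)
  qed
  also have "\<dots> = ennreal (2603 * q)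
      * (\<integral>\<^sup>+\<omega>. ennreal (\<bar>X 1 \<omega>\<bar> powr q * ln (38 * \<bar>X 1 \<omega>\<bar> powr q / \<epsilon> powr q + 1)) \<partial>M) / ennreal d"
    using d assms(5) by (simp add: divide_ennreal[symmetric] ennreal_divide_times ennreal_times_divide mult.commute)
  finally have third: "ennreal c * (\<integral>\<^sup>+\<omega>. ennreal (\<bar>Y 1 \<omega>\<bar> powr q * ln (38 * \<bar>Y 1 \<omega>\<bar> powr q + 1)) \<partial>M)
      \<le> ennreal (2603 * q)
      * (\<integral>\<^sup>+\<omega>. ennreal (\<bar>X 1 \<omega>\<bar> powr q * ln (38 * \<bar>X 1 \<omega>\<bar> powr q / \<epsilon> powr q + 1)) \<partial>M) / ennreal d" .
  have "(\<Sum>m. ennreal (tail_sup_prob M X q \<epsilon> (Suc m) / real (Suc m)))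
      = (\<Sum>m. ennreal (tail_sup_prob M Y q 1 (Suc m) / real (Suc m)))"
    unfolding Y_def[abs_def] tail_sup_prob_scale[OF assms(7)] ..
  also have "\<dots> \<le> (\<Sum>m. ennreal (measure M (Y.tail_excess q (Suc m)) / real (Suc m)))"
    by (intro suminf_le summableI ennreal_leI divide_right_mono Y.tail_sup_prob_le) auto
  also have "\<dots> \<le> 1 + ennreal (4 * q / (2 - q)\<^sup>2)
      + ennreal c * (\<integral>\<^sup>+\<omega>. ennreal (\<bar>Y 1 \<omega>\<bar> powr q * ln (38 * \<bar>Y 1 \<omega>\<bar> powr q + 1)) \<partial>M)"
    unfolding c_def using assms(5,6) by (rule Y.sum_tail_excess)
  also have "\<dots> \<le> 1 + ennreal (c\<^sub>q / (exp 1 * ln (2 powr (1 / q - 1 / 2))))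
      + ennreal (2603 * q)
      * (\<integral>\<^sup>+\<omega>. ennreal (\<bar>X 1 \<omega>\<bar> powr q * ln (38 * \<bar>X 1 \<omega>\<bar> powr q / \<epsilon> powr q + 1)) \<partial>M) / ennreal d"
    by (intro add_mono order_refl ennreal_leI main third)
  finally show ?thesis unfolding d_def .
qed

end
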